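(* Consider a stopping problem as described in the context, with a fixed information structure, and two discount factors $\delta$ and $\hat\delta$ with $1\ge\delta>\hat\delta>0$ (and $\delta<1$ if $N=\infty$). Let $A^N_n(\delta),A^N_n(\hat\delta)$ be the corresponding waiting sets and $E^N_n(\delta),E^N_n(\hat\delta)$ the corresponding stopping sets. Then for every period $n$, $$E^N_n(\delta)\subseteq E^N_n(\hat\delta)\quad\text{and}\quad A^N_n(\hat\delta)\subseteq A^N_n(\delta).$$ Moreover, for every prior belief $\mu_0\in\Delta\Theta$, the stopping time distribution induced by $\delta$ first-order stochastically dominates the one induced by $\hat\delta$; i.e. $\mathbb{P}(\tau_\delta>n)\ge\mathbb{P}(\tau_{\hat\delta}>n)$ for every $n$, where $\tau_\delta,\tau_{\hat\delta}$ are the stopping times under $\delta$ and $\hat\delta$.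
   Context: Setting. A decision maker faces a stopping problem with periods $n=0,1,\dots,N$, where $N\in\{1,2,\dots\}\cup\{\infty\}$, and an unknown time-invariant state $\theta\in\Theta=\{\theta_1,\dots,\theta_m\}$, $m\ge2$. $\Delta\Theta$ is the set of probability distributions on $\Theta$. $A$ is a nonempty compact action set; $u:A\times\Theta\to\mathbb{R}$ is bounded and continuous in $a$ for every $\theta$; $\pi(\mu):=\max_{a\in A}\sum_{\theta}u(a,\theta)\mu_\theta$ is the stopping payoff at belief $\mu$. Waiting beyond period $N$ (or never stopping) gives payoff $0$. Information. The information structure consists of a finite signal set and, for each $\theta$, a probability distribution $f_\theta$ on it. Signals are i.i.d. according to $f_\theta$ conditional on the state. Given belief $\mu$, signal $s$ has probability $\alpha_s(\mu)=\sum_\theta\mu_\theta f_\theta(s)$ and, if this is positive, the posterior is $\mu(s)=(\mu_\theta f_\theta(s)/\alpha_s(\mu))_\theta$. $\mathbb{E}(g(\mu(s))\mid\mu)=\sum_s\alpha_s(\mu)g(\mu(s))$. Value functions and sets. Only upfront fee schemes are considered, so no fees are charged after period $0$, and the value functions do not account for the upfront fee. For a discount factor $\delta$: $V^N_n(\mu;\delta)=\max\{\pi(\mu),\delta\,\mathbb{E}(V^N_{n+1}(\mu(s);\delta)\mid\mu)\}$ for $0\le n<N$, with $V^N_N(\mu;\delta)=\max\{\pi(\mu),0\}$ if $N<\infty$; if $N=\infty$ (and $\delta<1$) the $V^N_n$ are the unique uniformly bounded solution of the recursion. The stopping sets are $E^N_n(\delta)=\{\mu\in\Delta\Theta:V^N_n(\mu;\delta)=\pi(\mu)\}$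 and the waiting (information acquisition) sets are $A^N_n(\delta)=\Delta\Theta\setminus E^N_n(\delta)$. Stopping time. Starting from prior $\mu_0$, with $\theta$ drawn from $\mu_0$ and, conditional on $\theta$, signals $s_1,s_2,\dots$ drawn i.i.d. according to $f_\theta$, let $\mu_0(h_n)$ be the posterior after $h_n=(s_1,\dots,s_n)$ (with $\mu_0(h_0)=\mu_0$). The stopping time is $\tau_\delta=\min\{n\le N:\mu_0(h_n)\in E^N_n(\delta)\}$, with $\tau_\delta=\infty$ if there is no such $n$. *)

theory Defs
  imports "HOL-Probability.Probability"
begin

text \<open>
  The state space is a finite type \<open>'t\<close>, so that \<open>'t pmf\<close> is the set of all beliefs. The signal
  set is a finite type \<open>'s\<close>, and an information structure is a map \<open>f :: 't \<Rightarrow> 's pmf\<close>.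
  The action set \<open>A\<close> is a subset of a topological space.
\<close>

text \<open>The supremum below is a maximum when \<open>A\<close> is nonempty and compact and \<open>u\<close> is continuous
  in the action; see \<open>stop_payoff_is_max\<close>.\<close>

definition stop_payoff :: "'a set \<Rightarrow> ('a \<Rightarrow> 't::finite \<Rightarrow> real) \<Rightarrow> 't pmf \<Rightarrow> real" where
  "stop_payoff A u \<mu> = (SUP a\<in>A. \<Sum>\<theta>\<in>UNIV. u a \<theta> * pmf \<mu> \<theta>)"

lemma stop_payoff_is_max:
  fixes A :: "'a::topological_space set" and u :: "'a \<Rightarrow> 't::finite \<Rightarrow> real"
  assumes "compact A" "A \<noteq> {}" "\<And>\<theta>. continuous_on A (\<lambda>a. u a \<theta>)"
  shows "\<exists>a\<in>A. stop_payoff A u \<mu> = (\<Sum>\<theta>\<in>UNIV. u a \<theta> * pmf \<mu> \<theta>) \<and>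
           (\<forall>b\<in>A. (\<Sum>\<theta>\<in>UNIV. u b \<theta> * pmf \<mu> \<theta>) \<le> stop_payoff A u \<mu>)"
proof -
  let ?g = "\<lambda>a. \<Sum>\<theta>\<in>UNIV. u a \<theta> * pmf \<mu> \<theta>"
  have "continuous_on A ?g"
    by (intro continuous_intros assms(3))
  from continuous_attains_sup[OF assms(1,2) this]
  obtain a where a: "a \<in> A" "\<And>b. b \<in> A \<Longrightarrow> ?g b \<le> ?g a"
    by blast
  have "stop_payoff A u \<mu> = ?g a"
    unfolding stop_payoff_def by (rule cSup_eq_maximum) (use a in auto)
  then show ?thesis
    using a by auto
qed

definition signal_prob :: "('t::finite \<Rightarrow> 's pmf) \<Rightarrow> 't pmf \<Rightarrow> 's \<Rightarrow> real" where
  "signal_prob f \<mu> s = (\<Sum>\<theta>\<in>UNIV. pmf \<mu> \<theta> * pmf (f \<theta>) s)"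

text \<open>After a signal of probability zero the belief is left unchanged; this is an arbitrary
  convention without influence on expectations or on the law of the stopping time.\<close>

definition posterior :: "('t::finite \<Rightarrow> 's pmf) \<Rightarrow> 't pmf \<Rightarrow> 's \<Rightarrow> 't pmf" where
  "posterior f \<mu> s =
     (if signal_prob f \<mu> s > 0
      then embed_pmf (\<lambda>\<theta>. pmf \<mu> \<theta> * pmf (f \<theta>) s / signal_prob f \<mu> s)
      else \<mu>)"

lemma pmf_posterior:
  assumes "signal_prob f \<mu> s > 0"
  shows "pmf (posterior f \<mu> s) \<theta> = pmf \<mu> \<theta> * pmf (f \<theta>) s / signal_prob f \<mu> s"
proof -
  let ?p = "\<lambda>\<theta>. pmf \<mu> \<theta> * pmf (f \<theta>) s / signal_prob f \<mu> s"
  have nn: "?p \<theta> \<ge> 0" for \<theta>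
    using assms by simp
  have "(\<Sum>\<theta>\<in>UNIV. ?p \<theta>) = 1"
    using assms by (simp add: sum_divide_distrib[symmetric] signal_prob_def)
  then have "(\<integral>\<^sup>+\<theta>. ennreal (?p \<theta>) \<partial>count_space UNIV) = 1"
    using nn by (simp add: nn_integral_count_space_finite)
  then show ?thesis
    using assms nn by (simp add: posterior_def pmf_embed_pmf)
qed

definition posterior_expectation ::
  "('t::finite \<Rightarrow> 's::finite pmf) \<Rightarrow> ('t pmf \<Rightarrow> real) \<Rightarrow> 't pmf \<Rightarrow> real" where
  "posterior_expectation f g \<mu> = (\<Sum>s\<in>UNIV. signal_prob f \<mu> s * g (posterior f \<mu> s))"

text \<open>In the finite-horizon recursion only the periods \<open>n \<le> M\<close> are meaningful.\<close>

function value_fin :: "'a set \<Rightarrow> ('a \<Rightarrow> 't::finite \<Rightarrow> real) \<Rightarrow> ('t \<Rightarrow> 's::finite pmf) \<Rightarrow> real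
    \<Rightarrow> nat \<Rightarrow> nat \<Rightarrow> 't pmf \<Rightarrow> real" where
  "value_fin A u f \<delta> M n \<mu> =
     (if n < M
      then max (stop_payoff A u \<mu>)
             (\<delta> * posterior_expectation f (\<lambda>\<nu>. value_fin A u f \<delta> M (Suc n) \<nu>) \<mu>)
      else max (stop_payoff A u \<mu>) 0)"
  by auto
termination
  by (relation "Wellfounded.measure (\<lambda>(A, u, f, \<delta>, M, n, \<mu>). M - n)") auto

declare value_fin.simps [simp del]

text \<open>For \<open>0 < \<delta> < 1\<close> the right-hand side of the recursion is a contraction on the bounded
  functions of period and belief, so there is exactly one bounded solution.\<close>

definition value_inf :: "'a set \<Rightarrow> ('a \<Rightarrow> 't::finite \<Rightarrow> real) \<Rightarrow> ('t \<Rightarrow> 's::finite pmf) \<Rightarrow> real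
    \<Rightarrow> nat \<Rightarrow> 't pmf \<Rightarrow> real" where
  "value_inf A u f \<delta> = (THE V.
     (\<exists>B. \<forall>n \<mu>. \<bar>V n \<mu>\<bar> \<le> B) \<and>
     (\<forall>n \<mu>. V n \<mu> =
        max (stop_payoff A u \<mu>) (\<delta> * posterior_expectation f (V (Suc n)) \<mu>)))"

definition value_fun :: "'a set \<Rightarrow> ('a \<Rightarrow> 't::finite \<Rightarrow> real) \<Rightarrow> ('t \<Rightarrow> 's::finite pmf) \<Rightarrow> enat
    \<Rightarrow> real \<Rightarrow> nat \<Rightarrow> 't pmf \<Rightarrow> real" where
  "value_fun A u f N \<delta> =
     (case N of enat M \<Rightarrow> value_fin A u f \<delta> M | \<infinity> \<Rightarrow> value_inf A u f \<delta>)"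

definition stopping_set :: "'a set \<Rightarrow> ('a \<Rightarrow> 't::finite \<Rightarrow> real) \<Rightarrow> ('t \<Rightarrow> 's::finite pmf) \<Rightarrow> enat
    \<Rightarrow> real \<Rightarrow> nat \<Rightarrow> 't pmf set" where
  "stopping_set A u f N \<delta> n = {\<mu>. value_fun A u f N \<delta> n \<mu> = stop_payoff A u \<mu>}"

definition waiting_set :: "'a set \<Rightarrow> ('a \<Rightarrow> 't::finite \<Rightarrow> real) \<Rightarrow> ('t \<Rightarrow> 's::finite pmf) \<Rightarrow> enat
    \<Rightarrow> real \<Rightarrow> nat \<Rightarrow> 't pmf set" where
  "waiting_set A u f N \<delta> n = UNIV - stopping_set A u f N \<delta> n"

text \<open>A signal path is a sequence \<open>x :: nat \<Rightarrow> 's\<close> in which \<open>x i\<close> is the signal with index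
  \<open>i + 1\<close>, so that the history of period \<open>n\<close> consists of \<open>x 0, \<dots>, x (n - 1)\<close>.\<close>

primrec belief_at :: "('t::finite \<Rightarrow> 's pmf) \<Rightarrow> 't pmf \<Rightarrow> (nat \<Rightarrow> 's) \<Rightarrow> nat \<Rightarrow> 't pmf" where
  "belief_at f \<mu>\<^sub>0 x 0 = \<mu>\<^sub>0"
| "belief_at f \<mu>\<^sub>0 x (Suc n) = posterior f (belief_at f \<mu>\<^sub>0 x n) (x n)"

definition tau :: "'a set \<Rightarrow> ('a \<Rightarrow> 't::finite \<Rightarrow> real) \<Rightarrow> ('t \<Rightarrow> 's::finite pmf) \<Rightarrow> enat
    \<Rightarrow> real \<Rightarrow> 't pmf \<Rightarrow> (nat \<Rightarrow> 's) \<Rightarrow> enat" where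
  "tau A u f N \<delta> \<mu>\<^sub>0 x =
     (if \<exists>n. enat n \<le> N \<and> belief_at f \<mu>\<^sub>0 x n \<in> stopping_set A u f N \<delta> n
      then enat (LEAST n. enat n \<le> N \<and> belief_at f \<mu>\<^sub>0 x n \<in> stopping_set A u f N \<delta> n)
      else \<infinity>)"

text \<open>Joint law of the state and the signal path: the state is drawn from the prior and,
  conditional on the state \<open>\<theta>\<close>, the signals are i.i.d. according to \<open>f \<theta>\<close>.\<close>

definition path_law :: "('t::finite \<Rightarrow> 's::finite pmf) \<Rightarrow> 't pmf \<Rightarrow> ('t \<times> (nat \<Rightarrow> 's)) measure" where
  "path_law f \<mu>\<^sub>0 =
     measure_pmf \<mu>\<^sub>0 \<bind> (\<lambda>\<theta>.
       distr (\<Pi>\<^sub>M i\<in>UNIV. measure_pmf (f \<theta>))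
         (count_space UNIV \<Otimes>\<^sub>M (\<Pi>\<^sub>M i\<in>UNIV. count_space UNIV))
         (\<lambda>x. (\<theta>, x)))"

lemma path_kernel_measurable:
  fixes f :: "'t::finite \<Rightarrow> 's::finite pmf"
  shows "(\<lambda>x. (\<theta>, x)) \<in> (\<Pi>\<^sub>M i\<in>(UNIV::nat set). measure_pmf (f \<theta>)) \<rightarrow>\<^sub>M
           (count_space UNIV \<Otimes>\<^sub>M (\<Pi>\<^sub>M i\<in>UNIV. count_space UNIV))"
proof -
  have [measurable_cong]: "sets (\<Pi>\<^sub>M i\<in>(UNIV::nat set). measure_pmf (f \<theta>)) =
      sets (\<Pi>\<^sub>M i\<in>UNIV. count_space UNIV)"
    by (rule sets_PiM_cong) auto
  show ?thesis
    by measurable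
qed

lemma prob_space_path_kernel:
  fixes f :: "'t::finite \<Rightarrow> 's::finite pmf"
  shows "prob_space (distr (\<Pi>\<^sub>M i\<in>(UNIV::nat set). measure_pmf (f \<theta>))
           (count_space UNIV \<Otimes>\<^sub>M (\<Pi>\<^sub>M i\<in>UNIV. count_space UNIV)) (\<lambda>x. (\<theta>, x)))"
  by (intro prob_space.prob_space_distr prob_space_PiM path_kernel_measurable
        prob_space_measure_pmf)

lemma path_kernel_subprob:
  fixes f :: "'t::finite \<Rightarrow> 's::finite pmf"
  shows "(\<lambda>\<theta>. distr (\<Pi>\<^sub>M i\<in>(UNIV::nat set). measure_pmf (f \<theta>))
            (count_space UNIV \<Otimes>\<^sub>M (\<Pi>\<^sub>M i\<in>UNIV. count_space UNIV)) (\<lambda>x. (\<theta>, x)))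
         \<in> measure_pmf \<mu>\<^sub>0 \<rightarrow>\<^sub>M
           subprob_algebra (count_space UNIV \<Otimes>\<^sub>M (\<Pi>\<^sub>M i\<in>UNIV. count_space UNIV))"
  by (auto simp: space_subprob_algebra
      intro: prob_space_imp_subprob_space prob_space_path_kernel)

lemma sets_path_law:
  "sets (path_law f \<mu>\<^sub>0) = sets (count_space UNIV \<Otimes>\<^sub>M (\<Pi>\<^sub>M i\<in>UNIV. count_space UNIV))"
  unfolding path_law_def by (rule sets_bind) auto

lemma prob_space_path_law: "prob_space (path_law f \<mu>\<^sub>0)"
  unfolding path_law_def
  by (rule measure_pmf.prob_space_bind[OF _ path_kernel_subprob])
     (intro AE_pmfI prob_space_path_kernel)

end

theory Submission
  imports Defs
begin

text \<open>
  Waiting forever pays 0, so the value function is nonnegative, and hence a larger discount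
  factor raises the continuation payoff. The value function is therefore increasing in the
  discount factor, while it always lies above the stopping payoff: a belief at which a patient
  decision maker stops is one at which an impatient decision maker stops. So the impatient one
  stops no later along every signal path.

  For an infinite horizon, value iteration from 0 gives an increasing bounded sequence whose
  limit solves the recursion. Bounded solutions are compared by iterating the recursion: an
  error of at most \<open>c\<close> shrinks to \<open>\<delta> ^ k * c\<close> after \<open>k\<close> periods.
\<close>

section \<open>Posterior expectation as a monotone averaging operator\<close>

lemma signal_prob_nonneg: "signal_prob f \<mu> s \<ge> 0"
  unfolding signal_prob_def by (intro sum_nonneg) simp

lemma sum_signal_prob:
  fixes f :: "'t::finite \<Rightarrow> 's::finite pmf"
  shows "(\<Sum>s\<in>UNIV. signal_prob f \<mu> s) = 1"
proof -
  have "(\<Sum>s\<in>UNIV. signal_prob f \<mu> s) =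
      (\<Sum>\<theta>\<in>UNIV. pmf \<mu> \<theta> * (\<Sum>s\<in>UNIV. pmf (f \<theta>) s))"
    unfolding signal_prob_def by (subst sum.swap) (simp add: sum_distrib_left)
  also have "\<dots> = 1"
    by (simp add: sum_pmf_eq_1)
  finally show ?thesis .
qed

lemma posterior_expectation_mono:
  assumes "\<And>\<nu>. g \<nu> \<le> h \<nu>"
  shows "posterior_expectation f g \<mu> \<le> posterior_expectation f h \<mu>"
  unfolding posterior_expectation_def
  by (intro sum_mono mult_left_mono assms signal_prob_nonneg)

lemma posterior_expectation_const: "posterior_expectation f (\<lambda>_. c) \<mu> = c"
  unfolding posterior_expectation_def
  by (simp add: sum_distrib_right[symmetric] sum_signal_prob)

lemma posterior_expectation_add_const:
  "posterior_expectation f (\<lambda>\<nu>. g \<nu> + c) \<mu> = posterior_expectation f g \<mu> + c"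
  unfolding posterior_expectation_def
  by (simp add: distrib_left sum.distrib sum_distrib_right[symmetric] sum_signal_prob)

lemma posterior_expectation_nonneg:
  assumes "\<And>\<nu>. g \<nu> \<ge> 0"
  shows "posterior_expectation f g \<mu> \<ge> 0"
  using posterior_expectation_mono[of "\<lambda>_. 0" g f \<mu>] assms
  by (simp add: posterior_expectation_const)

text \<open>The two replacements are made one after the other: first \<open>g\<close> by
  \<open>h\<close>, then the discount factor. The second only raises the product because the
  expectation of \<open>h\<close> is nonnegative, so the sign condition falls on
  \<open>h\<close>.\<close>

lemma discounted_posterior_expectation_mono:
  assumes "0 \<le> \<delta>'" "\<delta>' \<le> \<delta>" "\<And>\<nu>. g \<nu> \<le> h \<nu>" "\<And>\<nu>. h \<nu> \<ge> 0"
  shows "\<delta>' * posterior_expectation f g \<mu> \<le> \<delta> * posterior_expectation f h \<mu>"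
proof -
  have "\<delta>' * posterior_expectation f g \<mu> \<le> \<delta>' * posterior_expectation f h \<mu>"
    using assms by (intro mult_left_mono posterior_expectation_mono)
  also have "\<dots> \<le> \<delta> * posterior_expectation f h \<mu>"
    using assms by (intro mult_right_mono posterior_expectation_nonneg)
  finally show ?thesis .
qed

lemma stop_payoff_le:
  fixes u :: "'a \<Rightarrow> 't::finite \<Rightarrow> real"
  assumes "A \<noteq> {}" "\<And>a \<theta>. a \<in> A \<Longrightarrow> u a \<theta> \<le> B"
  shows "stop_payoff A u \<mu> \<le> B"
  unfolding stop_payoff_def
proof (rule cSUP_least[OF assms(1)])
  fix a assume "a \<in> A"
  then have "(\<Sum>\<theta>\<in>UNIV. u a \<theta> * pmf \<mu> \<theta>) \<le> (\<Sum>\<theta>\<in>UNIV. B * pmf \<mu> \<theta>)"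
    using assms(2) by (intro sum_mono mult_right_mono) auto
  also have "\<dots> = B"
    by (simp add: sum_distrib_left[symmetric] sum_pmf_eq_1)
  finally show "(\<Sum>\<theta>\<in>UNIV. u a \<theta> * pmf \<mu> \<theta>) \<le> B" .
qed

subsection \<open>Finite horizon\<close>

lemma value_fin_nonneg:
  assumes "0 \<le> \<delta>"
  shows "value_fin A u f \<delta> M n \<mu> \<ge> 0"
\<comment> \<open>Backward induction on the number of remaining periods. Truncated subtraction puts
  every \<open>n \<ge> M\<close> into the base case, where the terminal payoff is a maximum with
  0.\<close>
proof (induction "M - n" arbitrary: n \<mu>)
  case 0
  then show ?case by (subst value_fin.simps) simp
next
  case (Suc k)
  have "value_fin A u f \<delta> M (Suc n) \<nu> \<ge> 0" for \<nu>
    using Suc by (intro Suc(1)) auto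
  then have "0 \<le> \<delta> * posterior_expectation f (\<lambda>\<nu>. value_fin A u f \<delta> M (Suc n) \<nu>) \<mu>"
    using assms by (intro mult_nonneg_nonneg posterior_expectation_nonneg)
  then show ?case
    using Suc(2) by (subst value_fin.simps) (auto simp: le_max_iff_disj)
qed

lemma value_fin_mono_discount:
  assumes "0 \<le> \<delta>'" "\<delta>' \<le> \<delta>"
  shows "value_fin A u f \<delta>' M n \<mu> \<le> value_fin A u f \<delta> M n \<mu>"
proof (induction "M - n" arbitrary: n \<mu>)
  case 0
  then show ?case by (subst (1 2) value_fin.simps) simp
next
  case (Suc k)
  have "value_fin A u f \<delta>' M (Suc n) \<nu> \<le> value_fin A u f \<delta> M (Suc n) \<nu>" for \<nu>
    using Suc by (intro Suc(1)) auto
  then have "\<delta>' * posterior_expectation f (\<lambda>\<nu>. value_fin A u f \<delta>' M (Suc n) \<nu>) \<mu>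
      \<le> \<delta> * posterior_expectation f (\<lambda>\<nu>. value_fin A u f \<delta> M (Suc n) \<nu>) \<mu>"
    using assms by (intro discounted_posterior_expectation_mono value_fin_nonneg) auto
  then show ?case
    using Suc(2) by (subst (1 2) value_fin.simps) (auto intro: max.mono)
qed

lemma stop_payoff_le_value_fin: "stop_payoff A u \<mu> \<le> value_fin A u f \<delta> M n \<mu>"
  by (subst value_fin.simps) simp

subsection \<open>Infinite horizon\<close>

text \<open>This is the predicate under \<open>THE\<close> in \<open>value_inf\<close>, with the
  stopping payoff abstracted to an arbitrary \<open>p\<close>.\<close>

definition bounded_solution :: "('t::finite pmf \<Rightarrow> real) \<Rightarrow> ('t \<Rightarrow> 's::finite pmf) \<Rightarrow> real
    \<Rightarrow> (nat \<Rightarrow> 't pmf \<Rightarrow> real) \<Rightarrow> bool" where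
  "bounded_solution p f \<delta> V \<longleftrightarrow>
     (\<exists>B. \<forall>n \<mu>. \<bar>V n \<mu>\<bar> \<le> B) \<and>
     (\<forall>n \<mu>. V n \<mu> = max (p \<mu>) (\<delta> * posterior_expectation f (V (Suc n)) \<mu>))"

lemma value_inf_eq: "value_inf A u f \<delta> = (THE V. bounded_solution (stop_payoff A u) f \<delta> V)"
  unfolding value_inf_def bounded_solution_def ..

lemma nonneg_if_ge_geometric:
  fixes x c \<delta> :: real
  assumes "0 \<le> \<delta>" "\<delta> < 1" "\<And>k. x + \<delta> ^ k * c \<ge> 0"
  shows "x \<ge> 0"
proof (rule LIMSEQ_le_const)
  show "(\<lambda>k. x + \<delta> ^ k * c) \<longlonglongrightarrow> x"
    using assms(1,2) by (auto intro!: tendsto_eq_intros LIMSEQ_power_zero)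
qed (use assms(3) in auto)

lemma bounded_solution_nonneg:
  assumes V: "bounded_solution p f \<delta> V" and \<delta>: "0 \<le> \<delta>" "\<delta> < 1"
  shows "V n \<mu> \<ge> 0"
proof -
  obtain B where B: "\<And>n \<mu>. \<bar>V n \<mu>\<bar> \<le> B"
    using V unfolding bounded_solution_def by blast
  \<comment> \<open>There is no terminal period to start a backward induction from. Instead
    \<open>k\<close> counts unfoldings of the recursion, with \<open>n\<close> arbitrary because
    each unfolding moves to \<open>Suc n\<close>; the bound \<open>B\<close> serves as the base
    case.\<close>
  have "V n \<mu> + \<delta> ^ k * B \<ge> 0" for k n \<mu>
  proof (induction k arbitrary: n \<mu>)
    case 0
    then show ?case using B[of n \<mu>] by (simp add: abs_le_iff)
  next
    case (Suc k)
    have "0 \<le> \<delta> * posterior_expectation f (\<lambda>\<nu>. V (Suc n) \<nu> + \<delta> ^ k * B) \<mu>"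
      using Suc \<delta> by (intro mult_nonneg_nonneg posterior_expectation_nonneg)
    also have "\<dots> = \<delta> * posterior_expectation f (V (Suc n)) \<mu> + \<delta> ^ Suc k * B"
      by (simp add: posterior_expectation_add_const algebra_simps)
    also have "\<dots> \<le> V n \<mu> + \<delta> ^ Suc k * B"
      using V unfolding bounded_solution_def by (metis add_right_mono max.cobounded2)
    finally show ?case .
  qed
  then show ?thesis
    using nonneg_if_ge_geometric[OF \<delta>] by blast
qed

text \<open>Allowing equal discount factors makes this serve twice: it compares different factors,
  and applied in both directions with the same factor it gives uniqueness of the bounded
  solution.\<close>

lemma bounded_solution_mono_discount:
  assumes V': "bounded_solution p f \<delta>' V'" and V: "bounded_solution p f \<delta> V"
    and \<delta>: "0 \<le> \<delta>'" "\<delta>' \<le> \<delta>" "\<delta> < 1"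
  shows "V' n \<mu> \<le> V n \<mu>"
proof -
  have V_nonneg: "V n \<mu> \<ge> 0" for n \<mu>
    using bounded_solution_nonneg[OF V] \<delta> by simp
  obtain B where B: "\<And>n \<mu>. \<bar>V' n \<mu>\<bar> \<le> B"
    using V' unfolding bounded_solution_def by blast
  have "B \<ge> 0"
    using B[of n \<mu>] by linarith
  have "V' n \<mu> \<le> V n \<mu> + \<delta>' ^ k * B" for k n \<mu>
  proof (induction k arbitrary: n \<mu>)
    case 0
    then show ?case using B[of n \<mu>] V_nonneg[of n \<mu>] by simp
  next
    case (Suc k)
    have "\<delta>' * posterior_expectation f (V' (Suc n)) \<mu>
        \<le> \<delta>' * posterior_expectation f (\<lambda>\<nu>. V (Suc n) \<nu> + \<delta>' ^ k * B) \<mu>"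
      using Suc \<delta> by (intro mult_left_mono posterior_expectation_mono)
    also have "\<dots> = \<delta>' * posterior_expectation f (V (Suc n)) \<mu> + \<delta>' ^ Suc k * B"
      by (simp add: posterior_expectation_add_const algebra_simps)
    also have "\<dots> \<le> \<delta> * posterior_expectation f (V (Suc n)) \<mu> + \<delta>' ^ Suc k * B"
      using \<delta> V_nonneg by (intro add_right_mono mult_right_mono posterior_expectation_nonneg)
    finally have cont: "\<delta>' * posterior_expectation f (V' (Suc n)) \<mu>
        \<le> \<delta> * posterior_expectation f (V (Suc n)) \<mu> + \<delta>' ^ Suc k * B" .
    \<comment> \<open>With a nonnegative error \<open>e\<close>,
      \<open>max p (x + e) \<le> max p x + e\<close>; the branch in which \<open>p\<close> attains
      the maximum relies on this sign.\<close>
    have "0 \<le> \<delta>' ^ Suc k * B"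
      using \<delta> \<open>B \<ge> 0\<close> by simp
    moreover have "V' n \<mu> = max (p \<mu>) (\<delta>' * posterior_expectation f (V' (Suc n)) \<mu>)"
      "V n \<mu> = max (p \<mu>) (\<delta> * posterior_expectation f (V (Suc n)) \<mu>)"
      using V V' unfolding bounded_solution_def by blast+
    ultimately show ?case
      using cont by linarith
  qed
  then have "0 \<le> V n \<mu> - V' n \<mu> + \<delta>' ^ k * B" for k
    by (simp add: algebra_simps)
  then show ?thesis
    using nonneg_if_ge_geometric[of \<delta>' "V n \<mu> - V' n \<mu>" B] \<delta> by simp
qed

section \<open>Existence of a bounded solution by value iteration\<close>

primrec value_iterate :: "('t::finite pmf \<Rightarrow> real) \<Rightarrow> ('t \<Rightarrow> 's::finite pmf) \<Rightarrow> real
    \<Rightarrow> nat \<Rightarrow> 't pmf \<Rightarrow> real" where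
  "value_iterate p f \<delta> 0 = (\<lambda>\<mu>. 0)"
| "value_iterate p f \<delta> (Suc k) =
     (\<lambda>\<mu>. max (p \<mu>) (\<delta> * posterior_expectation f (value_iterate p f \<delta> k) \<mu>))"

text \<open>The first step goes up because \<open>max (p \<mu>) 0\<close> is at least the starting
  value 0; monotonicity of the recursion operator carries this to all later steps.\<close>

lemma value_iterate_incseq:
  assumes "0 \<le> \<delta>"
  shows "incseq (\<lambda>k. value_iterate p f \<delta> k \<mu>)"
proof -
  have "value_iterate p f \<delta> k \<mu> \<le> value_iterate p f \<delta> (Suc k) \<mu>" for k \<mu>
  proof (induction k arbitrary: \<mu>)
    case 0
    then show ?case by (simp add: posterior_expectation_const)
  next
    case (Suc k)
    then have "\<delta> * posterior_expectation f (value_iterate p f \<delta> k) \<mu>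
        \<le> \<delta> * posterior_expectation f (value_iterate p f \<delta> (Suc k)) \<mu>"
      using assms by (intro mult_left_mono posterior_expectation_mono)
    then show ?case
      by (subst (1 2) value_iterate.simps(2)) (intro max.mono order.refl)
  qed
  then show ?thesis
    by (rule incseq_SucI)
qed

lemma value_iterate_le:
  assumes "0 \<le> \<delta>" "\<delta> \<le> 1" "0 \<le> B" "\<And>\<mu>. p \<mu> \<le> B"
  shows "value_iterate p f \<delta> k \<mu> \<le> B"
proof (induction k arbitrary: \<mu>)
  case 0
  then show ?case using assms(3) by simp
next
  case (Suc k)
  then have "\<delta> * posterior_expectation f (value_iterate p f \<delta> k) \<mu>
      \<le> \<delta> * posterior_expectation f (\<lambda>_. B) \<mu>"
    using assms(1) by (intro mult_left_mono posterior_expectation_mono)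
  also have "\<dots> \<le> B"
    using assms(1-3) by (simp add: posterior_expectation_const mult_left_le_one_le)
  finally show ?case
    using assms(4) by simp
qed

lemma bounded_solution_exists:
  fixes f :: "'t::finite \<Rightarrow> 's::finite pmf"
  assumes \<delta>: "0 \<le> \<delta>" "\<delta> \<le> 1" and p: "\<And>\<mu>. p \<mu> \<le> B"
  shows "\<exists>V. bounded_solution p f \<delta> V"
proof -
  let ?W = "value_iterate p f \<delta>"
  \<comment> \<open>The cap must dominate the starting value 0, and \<open>B\<close> itself may be
    negative.\<close>
  have le: "?W k \<mu> \<le> max B 0" for k \<mu>
    using \<delta> p by (intro value_iterate_le) (auto simp: le_max_iff_disj)
  have "\<exists>L. (\<lambda>k. ?W k \<mu>) \<longlonglongrightarrow> L \<and> (\<forall>k. ?W k \<mu> \<le> L)" for \<mu>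
    using incseq_convergent[OF value_iterate_incseq[OF \<delta>(1)], of p f \<mu> "max B 0"] le by metis
  then obtain L where L: "\<And>\<mu>. (\<lambda>k. ?W k \<mu>) \<longlonglongrightarrow> L \<mu>" "\<And>k \<mu>. ?W k \<mu> \<le> L \<mu>"
    by metis
  have "\<bar>L \<mu>\<bar> \<le> max B 0" for \<mu>
  proof -
    have "L \<mu> \<le> max B 0"
      using L(1) by (rule LIMSEQ_le_const2) (use le in blast)
    moreover have "0 \<le> L \<mu>"
      using L(2)[of 0 \<mu>] by simp
    ultimately show ?thesis by simp
  qed
  moreover have "L \<mu> = max (p \<mu>) (\<delta> * posterior_expectation f L \<mu>)" for \<mu>
  proof (rule LIMSEQ_unique)
    show "(\<lambda>k. ?W (Suc k) \<mu>) \<longlonglongrightarrow> L \<mu>"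
      using L(1) by (rule LIMSEQ_Suc)
    \<comment> \<open>Pointwise convergence suffices here, since the expectation is a finite sum
      over signals and \<open>max\<close> is continuous.\<close>
    show "(\<lambda>k. ?W (Suc k) \<mu>) \<longlonglongrightarrow> max (p \<mu>) (\<delta> * posterior_expectation f L \<mu>)"
      unfolding value_iterate.simps posterior_expectation_def
      by (intro tendsto_intros L(1))
  qed
  \<comment> \<open>The recursion has the same form in every period, so a solution constant in the
    period exists.\<close>
  ultimately have "bounded_solution p f \<delta> (\<lambda>_. L)"
    unfolding bounded_solution_def by blast
  then show ?thesis
    by blast
qed

text \<open>Unique existence is what gives access to the definite description defining
  \<open>value_inf\<close>.\<close>

lemma bounded_solution_value_inf:
  assumes \<delta>: "0 \<le> \<delta>" "\<delta> < 1" and "\<And>\<mu>. stop_payoff A u \<mu> \<le> B"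
  shows "bounded_solution (stop_payoff A u) f \<delta> (value_inf A u f \<delta>)"
proof -
  have "\<exists>!V. bounded_solution (stop_payoff A u) f \<delta> V"
  proof (rule ex_ex1I)
    show "\<exists>V. bounded_solution (stop_payoff A u) f \<delta> V"
      using assms by (intro bounded_solution_exists) auto
  next
    fix V W
    assume "bounded_solution (stop_payoff A u) f \<delta> V" "bounded_solution (stop_payoff A u) f \<delta> W"
    then have "V n \<mu> \<le> W n \<mu>" "W n \<mu> \<le> V n \<mu>" for n \<mu>
      using bounded_solution_mono_discount \<delta> by blast+
    then show "V = W"
      by (intro ext antisym)
  qed
  then show ?thesis
    unfolding value_inf_eq by (rule theI'[of "bounded_solution (stop_payoff A u) f \<delta>"])
qed

subsection \<open>Stopping sets and stopping times\<close>

lemma stopping_set_antimono_discount: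
  assumes \<delta>: "0 \<le> \<delta>'" "\<delta>' \<le> \<delta>" "N = \<infinity> \<Longrightarrow> \<delta> < 1"
    and bound: "\<And>\<mu>. stop_payoff A u \<mu> \<le> B"
  shows "stopping_set A u f N \<delta> n \<subseteq> stopping_set A u f N \<delta>' n"
proof -
  have "value_fun A u f N \<delta>' n \<mu> \<le> value_fun A u f N \<delta> n \<mu> \<and>
      stop_payoff A u \<mu> \<le> value_fun A u f N \<delta>' n \<mu>" for \<mu>
  proof (cases N)
    case (enat M)
    then show ?thesis
      using \<delta> by (simp add: value_fun_def value_fin_mono_discount stop_payoff_le_value_fin)
  next
    case infinity
    \<comment> \<open>Stated for all \<open>d\<close> up to \<delta>, so that it covers both
      discount factors.\<close>
    have sol: "bounded_solution (stop_payoff A u) f d (value_inf A u f d)"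
      if "0 \<le> d" "d \<le> \<delta>" for d
      using that \<delta>(3)[OF infinity] bound by (intro bounded_solution_value_inf) auto
    have "value_inf A u f \<delta>' n \<mu> \<le> value_inf A u f \<delta> n \<mu>"
      using \<delta>(3)[OF infinity] \<delta>(1,2)
      by (intro bounded_solution_mono_discount[OF sol sol]) auto
    moreover have "stop_payoff A u \<mu> \<le> value_inf A u f \<delta>' n \<mu>"
      using sol[OF \<delta>(1,2)] unfolding bounded_solution_def by (metis max.cobounded1)
    ultimately show ?thesis
      by (simp add: value_fun_def infinity)
  qed
  then show ?thesis
    unfolding stopping_set_def by (metis (mono_tags, lifting) mem_Collect_eq order_antisym subsetI)
qed

text \<open>Reduces the event to finitely many conditions on beliefs. Paths on which stopping never
  occurs satisfy both sides, as \<open>tau\<close> is then infinite; periods beyond \<open>N\<close>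
  impose no condition.\<close>

lemma tau_gt_iff:
  "tau A u f N \<delta> \<mu>\<^sub>0 x > enat n \<longleftrightarrow>
     (\<forall>k\<le>n. enat k \<le> N \<longrightarrow> belief_at f \<mu>\<^sub>0 x k \<notin> stopping_set A u f N \<delta> k)"
proof -
  let ?P = "\<lambda>k. enat k \<le> N \<and> belief_at f \<mu>\<^sub>0 x k \<in> stopping_set A u f N \<delta> k"
  have "n < Least ?P \<longleftrightarrow> (\<forall>k\<le>n. \<not> ?P k)" if "\<exists>k. ?P k"
    using LeastI_ex[OF that] not_less_Least[of _ ?P] by (meson le_less_trans not_le)
  then show ?thesis
    unfolding tau_def by auto
qed

text \<open>The belief in period \<open>k\<close> is determined by \<open>k\<close> signals from a
  finite set, so every predicate of it is measurable and no sigma-algebra on beliefs has to be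
  chosen.\<close>

lemma measurable_belief_at_pred:
  fixes f :: "'t::finite \<Rightarrow> 's::finite pmf"
  shows "Measurable.pred (\<Pi>\<^sub>M i\<in>(UNIV::nat set). count_space UNIV)
    (\<lambda>x. P (belief_at f \<mu>\<^sub>0 x k))"
proof (induction k arbitrary: P)
  case 0
  then show ?case by simp
next
  case (Suc k)
  have [measurable]: "Measurable.pred (\<Pi>\<^sub>M i\<in>UNIV. count_space UNIV)
      (\<lambda>x. P (posterior f (belief_at f \<mu>\<^sub>0 x k) s))" for s
    by (rule Suc)
  \<comment> \<open>Splitting on the value of the last signal turns the update into a predicate of
    the previous belief, to which the induction hypothesis for arbitrary \<open>P\<close>
    applies.\<close>
  have "(\<lambda>x. P (belief_at f \<mu>\<^sub>0 x (Suc k))) =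
      (\<lambda>x. \<exists>s. x k = s \<and> P (posterior f (belief_at f \<mu>\<^sub>0 x k) s))"
    by auto
  also have "Measurable.pred (\<Pi>\<^sub>M i\<in>UNIV. count_space UNIV) \<dots>"
    by measurable
  finally show ?case .
qed

lemma sets_tau_gt:
  fixes f :: "'t::finite \<Rightarrow> 's::finite pmf"
  shows "{\<omega> \<in> space (path_law f \<mu>\<^sub>0). tau A u f N \<delta> \<mu>\<^sub>0 (snd \<omega>) > enat n}
    \<in> sets (path_law f \<mu>\<^sub>0)"
proof -
  have [measurable]: "Measurable.pred (\<Pi>\<^sub>M i\<in>UNIV. count_space UNIV)
      (\<lambda>x. belief_at f \<mu>\<^sub>0 x k \<notin> stopping_set A u f N \<delta> k)" for k
    by (rule measurable_belief_at_pred)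
  have "Measurable.pred (\<Pi>\<^sub>M i\<in>UNIV. count_space UNIV)
      (\<lambda>x. tau A u f N \<delta> \<mu>\<^sub>0 x > enat n)"
    unfolding tau_gt_iff by measurable
  then have "Measurable.pred (count_space UNIV \<Otimes>\<^sub>M (\<Pi>\<^sub>M i\<in>UNIV. count_space UNIV))
      (\<lambda>\<omega>. tau A u f N \<delta> \<mu>\<^sub>0 (snd \<omega>) > enat n)"
    by measurable
  then show ?thesis
    unfolding pred_def sets_path_law sets_eq_imp_space_eq[OF sets_path_law] .
qed

theorem proposition4:
  fixes A :: "'a::topological_space set"
    and u :: "'a \<Rightarrow> 't::finite \<Rightarrow> real"
    and f :: "'t \<Rightarrow> 's::finite pmf"
    and N :: enat
    and \<delta> \<delta>' :: real
  assumes "CARD('t) \<ge> 2"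
    and "compact A" and "A \<noteq> {}"
    and "bounded ((\<lambda>(a, \<theta>). u a \<theta>) ` (A \<times> UNIV))"
    and "\<And>\<theta>. continuous_on A (\<lambda>a. u a \<theta>)"
    and "N \<ge> 1"
    and "1 \<ge> \<delta>" and "\<delta> > \<delta>'" and "\<delta>' > 0"
    and "N = \<infinity> \<Longrightarrow> \<delta> < 1"
  shows "(\<forall>n. enat n \<le> N \<longrightarrow>
            stopping_set A u f N \<delta> n \<subseteq> stopping_set A u f N \<delta>' n \<and>
            waiting_set A u f N \<delta>' n \<subseteq> waiting_set A u f N \<delta> n) \<and>
         (\<forall>\<mu>\<^sub>0. \<forall>n::nat.
            measure (path_law f \<mu>\<^sub>0)
              {\<omega> \<in> space (path_law f \<mu>\<^sub>0). tau A u f N \<delta> \<mu>\<^sub>0 (snd \<omega>) > enat n}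
            \<ge> measure (path_law f \<mu>\<^sub>0)
              {\<omega> \<in> space (path_law f \<mu>\<^sub>0). tau A u f N \<delta>' \<mu>\<^sub>0 (snd \<omega>) > enat n})"
proof -
  obtain B where "\<And>a \<theta>. a \<in> A \<Longrightarrow> \<bar>u a \<theta>\<bar> \<le> B"
    using assms(4) unfolding bounded_iff by fastforce
  then have "stop_payoff A u \<mu> \<le> B" for \<mu>
    using assms(3) by (intro stop_payoff_le) (auto simp: abs_le_iff)
  then have stop: "stopping_set A u f N \<delta> n \<subseteq> stopping_set A u f N \<delta>' n" for n
    using assms(8-10) by (intro stopping_set_antimono_discount) auto
  have "measure (path_law f \<mu>\<^sub>0)
      {\<omega> \<in> space (path_law f \<mu>\<^sub>0). tau A u f N \<delta>' \<mu>\<^sub>0 (snd \<omega>) > enat n}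
    \<le> measure (path_law f \<mu>\<^sub>0)
      {\<omega> \<in> space (path_law f \<mu>\<^sub>0). tau A u f N \<delta> \<mu>\<^sub>0 (snd \<omega>) > enat n}" for \<mu>\<^sub>0 n
  proof -
    interpret prob_space "path_law f \<mu>\<^sub>0"
      by (rule prob_space_path_law)
    show ?thesis
      \<comment> \<open>Monotonicity of the measure also requires the larger event to be measurable,
        which \<open>sets_tau_gt\<close> provides.\<close>
      using stop by (intro finite_measure_mono sets_tau_gt) (auto simp: tau_gt_iff)
  qed
  then show ?thesis
    using stop unfolding waiting_set_def by blast
qed

end
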